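(* Let $n\geq 1$. Consider $n$ gossipers, each initially knowing only their own distinct piece of gossip. A phone call between two distinct gossipers results in both knowing the union of what the two knew before the call. Then any sequence of phone calls such that in each call at least one of the two participants learns something new has length at most $\binom{n}{2}$, and for every $n$ there exists such a sequence of length exactly $\binom{n}{2}$. *)

theory Defs
  imports Main
begin

text \<open>The \<open>n\<close> gossipers are the numbers below \<open>n\<close>; the piece of gossip that gossiper \<open>i\<close> starts
  with is identified with \<open>i\<close> itself. A state assigns to each gossiper the set of pieces known.\<close>

type_synonym knowledge = "nat \<Rightarrow> nat set"

definition initial_knowledge :: knowledge where
  "initial_knowledge = (\<lambda>i. {i})"

definition phone_call :: "nat \<Rightarrow> nat \<Rightarrow> knowledge \<Rightarrow> knowledge" where
  "phone_call a b K = K(a := K a \<union> K b, b := K a \<union> K b)"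

definition learns_in_call :: "nat \<Rightarrow> nat \<Rightarrow> nat \<Rightarrow> knowledge \<Rightarrow> bool" where
  "learns_in_call i a b K \<longleftrightarrow> K i \<subset> phone_call a b K i"

text \<open>\<open>informative_calls n K cs\<close>: starting from state \<open>K\<close>, the calls in \<open>cs\<close>, made in list order,
  are between distinct gossipers below \<open>n\<close>, and in each one some participant learns something.
  A call is an ordered pair, but the order of its components has no effect.\<close>

fun informative_calls :: "nat \<Rightarrow> knowledge \<Rightarrow> (nat \<times> nat) list \<Rightarrow> bool" where
  "informative_calls n K [] \<longleftrightarrow> True"
| "informative_calls n K ((a, b) # cs) \<longleftrightarrow>
     a < n \<and> b < n \<and> a \<noteq> b \<and>
     (learns_in_call a a b K \<or> learns_in_call b a b K) \<and>
     informative_calls n (phone_call a b K) cs"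

end

theory Submission
  imports Defs Complex_Main "HOL-Library.Function_Algebras"
begin

text \<open>
  Upper bound: represent the knowledge sets as the supports of an orthonormal family
  \<open>v 0, \<dots>, v (n - 1)\<close> in real \<open>n\<close>-space, starting from the standard basis; a call between \<open>a\<close> and
  \<open>b\<close> rotates the pair \<open>v a, v b\<close> by a generic angle, so that both supports become the union.
  Consider the space of skew-symmetric matrices \<open>X\<close> such that the support of \<open>X (v i)\<close> is
  contained in \<open>K i\<close> for every \<open>i\<close>. A call does not shrink this space. After the call it contains
  the wedge of the old vectors \<open>v a\<close> and \<open>v b\<close>, which maps the old \<open>v a\<close> to \<open>- v b\<close> and \<open>v b\<close> to
  \<open>v a\<close>, and therefore did not belong to it before if the call was informative. So each
  informative call raises the dimension, which is at most \<open>n choose 2\<close>.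

  Lower bound: let the first \<open>n\<close> gossipers finish a longest sequence among themselves; then the
  last one calls each of them in turn.
\<close>

section \<open>Skew-symmetric matrices\<close>

definition matrix_scale :: "real \<Rightarrow> (nat \<Rightarrow> nat \<Rightarrow> real) \<Rightarrow> nat \<Rightarrow> nat \<Rightarrow> real" where
  "matrix_scale c X = (\<lambda>i j. c * X i j)"

definition skew_matrices :: "nat \<Rightarrow> (nat \<Rightarrow> nat \<Rightarrow> real) set" where
  "skew_matrices n = {X. (\<forall>i j. X i j = - X j i) \<and> (\<forall>i j. X i j \<noteq> 0 \<longrightarrow> i < n \<and> j < n)}"

definition skew_unit :: "nat \<Rightarrow> nat \<Rightarrow> nat \<Rightarrow> nat \<Rightarrow> real" where
  "skew_unit p q = (\<lambda>i j. (if i = p \<and> j = q then 1 else 0) - (if i = q \<and> j = p then 1 else 0))"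

lemma matrix_scale_skew_unit:
  "matrix_scale c (skew_unit p q) i j =
    (if i = p \<and> j = q then c else 0) - (if i = q \<and> j = p then c else 0)"
  by (simp only: matrix_scale_def skew_unit_def right_diff_distrib if_distrib[of "(*) c"]
      mult_1_right mult_zero_right)

interpretation mat: vector_space matrix_scale
  by unfold_locales (auto simp: matrix_scale_def fun_eq_iff algebra_simps)

lemma finite_ordered_pairs: "finite (SIGMA q:{..<n::nat}. {..<q})"
  by auto

lemma card_ordered_pairs: "card (SIGMA q:{..<n}. {..<q}) = n choose 2"
proof -
  have "(\<Sum>q<n. q) = n choose 2"
    by (induction n) (auto simp: numeral_2_eq_2)
  then show ?thesis
    by simp
qed

text \<open>A skew-symmetric matrix is determined by its entries above the diagonal, which serve as
  the coefficients of the matrices \<open>skew_unit p q\<close> with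
  \<open>p < q < n\<close>.\<close>

lemma skew_matrices_in_span:
  "skew_matrices n \<subseteq> mat.span ((\<lambda>(q, p). skew_unit p q) ` (SIGMA q:{..<n}. {..<q}))"
proof
  fix X assume X: "X \<in> skew_matrices n"
  let ?S = "SIGMA q:{..<n}. {..<q}"
  let ?Y = "\<Sum>(q, p)\<in>?S. matrix_scale (X p q) (skew_unit p q)"
  have entry: "(\<Sum>x\<in>S. f x) i j = (\<Sum>x\<in>S. f x i j)"
    for f :: "nat \<times> nat \<Rightarrow> nat \<Rightarrow> nat \<Rightarrow> real" and S i j
    by (induction S rule: infinite_finite_induct) auto
  have "X i j = ?Y i j" for i j
  proof -
    have sk: "X i j = - X j i" and supp: "X i j \<noteq> 0 \<longrightarrow> i < n \<and> j < n"
      using X unfolding skew_matrices_def by blast+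
    have "?Y i j = (\<Sum>x\<in>?S. (case x of (q, p) \<Rightarrow> matrix_scale (X p q) (skew_unit p q)) i j)"
      by (rule entry)
    \<comment> \<open>The larger index comes first in \<open>?S\<close>, so entry
      \<open>(i, j)\<close> is met with sign plus at \<open>(j, i)\<close> and with sign minus at
      \<open>(i, j)\<close>; at most one of these two pairs lies in \<open>?S\<close>.\<close>
    also have "\<dots> = (\<Sum>x\<in>?S. (if x = (j, i) then X i j else 0) - (if x = (i, j) then X j i else 0))"
    proof (rule sum.cong[OF refl])
      fix x :: "nat \<times> nat"
      obtain q p where x: "x = (q, p)"
        by (cases x)
      show "(case x of (q, p) \<Rightarrow> matrix_scale (X p q) (skew_unit p q)) i j =
          (if x = (j, i) then X i j else 0) - (if x = (i, j) then X j i else 0)"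
        unfolding x prod.case matrix_scale_skew_unit
        by (intro arg_cong2[where f = "(-)"] if_cong) auto
    qed
    also have "\<dots> = (if (j, i) \<in> ?S then X i j else 0) - (if (i, j) \<in> ?S then X j i else 0)"
      by (simp only: sum_subtractf sum.delta[OF finite_ordered_pairs])
    also have "\<dots> = X i j"
    proof (cases i j rule: linorder_cases)
      case equal
      with sk show ?thesis
        by simp
    next
      case greater
      with sk supp show ?thesis
        by (cases "X i j = 0") simp_all
    qed (use supp in auto)
    finally show ?thesis ..
  qed
  then have "X = ?Y"
    by blast
  moreover have "?Y \<in> mat.span ((\<lambda>(q, p). skew_unit p q) ` ?S)"
  proof (rule mat.span_sum)
    fix x assume "x \<in> ?S"
    moreover obtain q p where "x = (q, p)"
      by (cases x)
    ultimately show "(case x of (q, p) \<Rightarrow> matrix_scale (X p q) (skew_unit p q))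
        \<in> mat.span ((\<lambda>(q, p). skew_unit p q) ` ?S)"
      by (auto intro!: mat.span_scale intro: mat.span_base)
  qed
  ultimately show "X \<in> mat.span ((\<lambda>(q, p). skew_unit p q) ` ?S)"
    by simp
qed

lemma card_independent_skew_le:
  assumes "mat.independent B" "B \<subseteq> skew_matrices n"
  shows "finite B \<and> card B \<le> n choose 2"
proof -
  let ?T = "(\<lambda>(q, p). skew_unit p q) ` (SIGMA q:{..<n}. {..<q})"
  have "finite B \<and> card B \<le> card ?T"
    using assms skew_matrices_in_span finite_ordered_pairs by (intro mat.independent_span_bound) auto
  moreover have "card ?T \<le> n choose 2"
    using card_image_le[OF finite_ordered_pairs] card_ordered_pairs by metis
  ultimately show ?thesis
    by linarith
qed

section \<open>Orthonormal families realizing a state\<close>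

definition dot :: "nat \<Rightarrow> (nat \<Rightarrow> real) \<Rightarrow> (nat \<Rightarrow> real) \<Rightarrow> real" where
  "dot n u w = (\<Sum>k<n. u k * w k)"

definition realizes :: "nat \<Rightarrow> knowledge \<Rightarrow> (nat \<Rightarrow> nat \<Rightarrow> real) \<Rightarrow> bool" where
  "realizes n K v \<longleftrightarrow>
     (\<forall>i<n. K i \<subseteq> {..<n} \<and> (\<forall>j. v i j \<noteq> 0 \<longleftrightarrow> j \<in> K i)) \<and>
     (\<forall>i<n. \<forall>k<n. dot n (v i) (v k) = (if i = k then 1 else 0))"

text \<open>Since \<open>X j\<close> is row \<open>j\<close> of \<open>X\<close>,
  \<open>dot n (X j) (v i)\<close> is coordinate \<open>j\<close> of the product of \<open>X\<close>
  with \<open>v i\<close>.\<close>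

definition compatible :: "nat \<Rightarrow> knowledge \<Rightarrow> (nat \<Rightarrow> nat \<Rightarrow> real) \<Rightarrow> (nat \<Rightarrow> nat \<Rightarrow> real) set" where
  "compatible n K v = {X \<in> skew_matrices n. \<forall>i<n. \<forall>j. j \<notin> K i \<longrightarrow> dot n (X j) (v i) = 0}"

definition wedge :: "(nat \<Rightarrow> real) \<Rightarrow> (nat \<Rightarrow> real) \<Rightarrow> nat \<Rightarrow> nat \<Rightarrow> real" where
  "wedge u w = (\<lambda>i j. u i * w j - w i * u j)"

definition rotate_pair ::
    "real \<Rightarrow> real \<Rightarrow> nat \<Rightarrow> nat \<Rightarrow> (nat \<Rightarrow> nat \<Rightarrow> real) \<Rightarrow> nat \<Rightarrow> nat \<Rightarrow> real" where
  "rotate_pair c s a b v = v(a := (\<lambda>j. c * v a j + s * v b j), b := (\<lambda>j. c * v b j - s * v a j))"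

lemma dot_commute: "dot n u w = dot n w u"
  by (simp add: dot_def mult.commute)

lemma dot_lincomb:
  "dot n x (\<lambda>j. c * u j + s * w j) = c * dot n x u + s * dot n x w"
  "dot n x (\<lambda>j. c * u j - s * w j) = c * dot n x u - s * dot n x w"
  by (simp_all add: dot_def sum.distrib sum_subtractf sum_distrib_left algebra_simps)

lemma dot_lincomb_left:
  "dot n (\<lambda>j. c * u j + s * w j) x = c * dot n u x + s * dot n w x"
  "dot n (\<lambda>j. c * u j - s * w j) x = c * dot n u x - s * dot n w x"
  by (simp_all add: dot_commute[of n _ x] dot_lincomb)

lemma dot_wedge: "dot n (wedge u w i) x = u i * dot n w x - w i * dot n u x"
  by (simp add: wedge_def dot_lincomb_left)

lemma realizesD:
  assumes "realizes n K v" "i < n"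
  shows "K i \<subseteq> {..<n}" "v i j \<noteq> 0 \<longleftrightarrow> j \<in> K i"
    and "k < n \<Longrightarrow> dot n (v i) (v k) = (if i = k then 1 else 0)"
  using assms by (auto simp: realizes_def)

lemma realizes_initial: "realizes n initial_knowledge (\<lambda>i j. if i = j then 1 else 0)"
proof -
  have "dot n (\<lambda>j. if i = j then 1 else 0) (\<lambda>j. if k = j then 1 else 0) = (if i = k then 1 else 0)"
    if "i < n" for i k
  proof -
    have "dot n (\<lambda>j. if i = j then 1 else 0) (\<lambda>j. if k = j then 1 else 0) =
        (\<Sum>j<n. if i = j then (if k = i then 1 else 0) else 0)"
      unfolding dot_def by (rule sum.cong) auto
    then show ?thesis
      using that by simp
  qed
  then show ?thesis
    by (simp add: realizes_def initial_knowledge_def)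
qed

lemma subspace_compatible: "mat.subspace (compatible n K v)"
proof (rule mat.subspaceI)
  show "0 \<in> compatible n K v"
    by (auto simp: compatible_def skew_matrices_def dot_def)
next
  fix X Y assume XY: "X \<in> compatible n K v" "Y \<in> compatible n K v"
  have "dot n ((X + Y) j) x = dot n (X j) x + dot n (Y j) x" for j x
    by (simp add: dot_def algebra_simps sum.distrib)
  moreover have "X + Y \<in> skew_matrices n"
    unfolding skew_matrices_def
  proof (intro CollectI conjI allI)
    fix i j
    have sk: "X i j = - X j i" "Y i j = - Y j i"
      using XY unfolding compatible_def skew_matrices_def by blast+
    show "(X + Y) i j = - (X + Y) j i"
      unfolding plus_fun_apply sk by simp
    have "X i j \<noteq> 0 \<longrightarrow> i < n \<and> j < n" "Y i j \<noteq> 0 \<longrightarrow> i < n \<and> j < n"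
      using XY unfolding compatible_def skew_matrices_def by blast+
    then show "(X + Y) i j \<noteq> 0 \<longrightarrow> i < n \<and> j < n"
      by auto
  qed
  ultimately show "X + Y \<in> compatible n K v"
    using XY by (simp add: compatible_def)
next
  fix c X assume X: "X \<in> compatible n K v"
  have "dot n (matrix_scale c X j) x = c * dot n (X j) x" for j x
    by (simp add: dot_def matrix_scale_def sum_distrib_left mult.assoc)
  moreover have "matrix_scale c X \<in> skew_matrices n"
    unfolding skew_matrices_def
  proof (intro CollectI conjI allI)
    fix i j
    have sk: "X i j = - X j i" and supp: "X i j \<noteq> 0 \<longrightarrow> i < n \<and> j < n"
      using X unfolding compatible_def skew_matrices_def by blast+
    show "matrix_scale c X i j = - matrix_scale c X j i"
      unfolding matrix_scale_def sk by simp
    show "matrix_scale c X i j \<noteq> 0 \<longrightarrow> i < n \<and> j < n"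
      using supp by (simp add: matrix_scale_def)
  qed
  ultimately show "matrix_scale c X \<in> compatible n K v"
    using X by (auto simp: compatible_def)
qed

text \<open>Each coordinate rules out only finitely many values of the tangent \<open>t\<close> of
  the angle, so some real \<open>t\<close> avoids them all.\<close>

lemma ex_generic_rotation:
  fixes u w :: "nat \<Rightarrow> real"
  shows "\<exists>c s. c\<^sup>2 + s\<^sup>2 = 1 \<and>
    (\<forall>j<n. u j \<noteq> 0 \<or> w j \<noteq> 0 \<longrightarrow> c * u j + s * w j \<noteq> 0 \<and> c * w j - s * u j \<noteq> 0)"
proof -
  \<comment> \<open>The quotients are the zeros in \<open>t\<close> of \<open>u j + t * w j\<close>
    and \<open>w j - t * u j\<close> when both entries are nonzero; excluding 0 handles coordinates
    where exactly one entry vanishes.\<close>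
  let ?bad = "insert 0 ((\<lambda>j. - u j / w j) ` {..<n} \<union> (\<lambda>j. w j / u j) ` {..<n})"
  obtain t where t: "t \<notin> ?bad"
    using ex_new_if_finite[OF infinite_UNIV_char_0, of ?bad] by auto
  \<comment> \<open>Cosine of an angle with tangent \<open>t\<close>; the sine is then
    \<open>c * t\<close>.\<close>
  define c where "c = 1 / sqrt (1 + t\<^sup>2)"
  have pos: "1 + t\<^sup>2 > 0"
    by (simp add: add_pos_nonneg)
  then have c: "c \<noteq> 0" "c\<^sup>2 * (1 + t\<^sup>2) = 1"
    by (auto simp: c_def power_divide)
  have "u j + t * w j \<noteq> 0 \<and> w j - t * u j \<noteq> 0" if "j < n" "u j \<noteq> 0 \<or> w j \<noteq> 0" for j
  proof -
    have "t \<noteq> 0" "t \<noteq> - u j / w j" "t \<noteq> w j / u j"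
      using t that(1) by auto
    then show ?thesis
      using that(2) by (cases "u j = 0"; cases "w j = 0") (auto simp: field_simps)
  qed
  then have "c * u j + (c * t) * w j \<noteq> 0 \<and> c * w j - (c * t) * u j \<noteq> 0"
    if "j < n" "u j \<noteq> 0 \<or> w j \<noteq> 0" for j
    using that c(1) by (simp add: mult.assoc flip: distrib_left right_diff_distrib)
  moreover have "c\<^sup>2 + (c * t)\<^sup>2 = 1"
    using c(2) by (simp add: power_mult_distrib algebra_simps)
  ultimately show ?thesis
    by blast
qed

text \<open>A rotation in the plane of \<open>v a\<close> and \<open>v b\<close> keeps the family
  orthonormal, and a generic angle prevents cancellation on the union of the two supports.\<close>

lemma ex_realizes_phone_call:
  assumes R: "realizes n K v" and ab: "a < n" "b < n" "a \<noteq> b"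
  shows "\<exists>c s. realizes n (phone_call a b K) (rotate_pair c s a b v)"
proof -
  obtain c s where cs: "c\<^sup>2 + s\<^sup>2 = 1"
    and gen: "\<And>j. j < n \<Longrightarrow> v a j \<noteq> 0 \<or> v b j \<noteq> 0 \<Longrightarrow>
      c * v a j + s * v b j \<noteq> 0 \<and> c * v b j - s * v a j \<noteq> 0"
    using ex_generic_rotation[of n "v a" "v b"] by blast
  note RD = realizesD[OF R]
  have supp: "c * v a j + s * v b j \<noteq> 0 \<longleftrightarrow> j \<in> K a \<union> K b"
             "c * v b j - s * v a j \<noteq> 0 \<longleftrightarrow> j \<in> K a \<union> K b" for j
    using gen[of j] RD(1)[OF ab(1)] RD(1)[OF ab(2)] RD(2)[OF ab(1), of j] RD(2)[OF ab(2), of j]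
    by (cases "j < n"; auto)+
  have "realizes n (phone_call a b K) (rotate_pair c s a b v)"
    unfolding realizes_def
  proof (intro conjI allI impI)
    fix i assume i: "i < n"
    show "phone_call a b K i \<subseteq> {..<n}"
      using RD(1)[OF i] RD(1)[OF ab(1)] RD(1)[OF ab(2)] by (auto simp: phone_call_def)
    fix j
    show "rotate_pair c s a b v i j \<noteq> 0 \<longleftrightarrow> j \<in> phone_call a b K i"
      using supp[of j] RD(2)[OF i, of j] ab(3) by (simp add: rotate_pair_def phone_call_def)
  next
    fix i k assume "i < n" "k < n"
    then show "dot n (rotate_pair c s a b v i) (rotate_pair c s a b v k) = (if i = k then 1 else 0)"
      using ab cs
      by (auto simp: rotate_pair_def dot_lincomb dot_lincomb_left RD(3) power2_eq_square)
  qed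
  then show ?thesis
    by blast
qed

text \<open>By linearity, \<open>X\<close> sends the rotated vectors to combinations of the images
  of \<open>v a\<close> and \<open>v b\<close>, whose supports lie in \<open>K a\<close> and
  \<open>K b\<close>.\<close>

lemma compatible_phone_call_mono:
  "a < n \<Longrightarrow> b < n \<Longrightarrow>
    compatible n K v \<subseteq> compatible n (phone_call a b K) (rotate_pair c s a b v)"
  by (auto simp: compatible_def phone_call_def rotate_pair_def dot_lincomb)

lemma wedge_skew:
  assumes "realizes n K v" "a < n" "b < n"
  shows "wedge (v a) (v b) \<in> skew_matrices n"
  using realizesD(1,2)[OF assms(1,2)] realizesD(1,2)[OF assms(1,3)]
  by (fastforce simp: skew_matrices_def wedge_def)

text \<open>The image of the wedge lies in the span of \<open>v a\<close> and \<open>v b\<close>,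
  hence is supported in \<open>K a \<union> K b\<close>; every other \<open>v i\<close> is
  orthogonal to both and is sent to 0.\<close>

lemma wedge_compatible_phone_call:
  assumes R: "realizes n K v" and ab: "a < n" "b < n" "a \<noteq> b"
  shows "wedge (v a) (v b) \<in> compatible n (phone_call a b K) (rotate_pair c s a b v)"
proof -
  note RD = realizesD[OF R]
  have "dot n (wedge (v a) (v b) j) (rotate_pair c s a b v i) = 0"
    if "i < n" "j \<notin> phone_call a b K i" for i j
    using that ab RD(2)[OF ab(1), of j] RD(2)[OF ab(2), of j]
    by (auto simp: dot_wedge rotate_pair_def phone_call_def dot_lincomb RD(3) split: if_splits)
  then show ?thesis
    using wedge_skew[OF R ab(1,2)] by (simp add: compatible_def)
qed

text \<open>A piece in \<open>K b\<close> but not in \<open>K a\<close> lies in the support of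
  \<open>- v b\<close>, the image of \<open>v a\<close>; the other case is symmetric, with
  \<open>v b\<close> sent to \<open>v a\<close>.\<close>

lemma wedge_not_compatible:
  assumes R: "realizes n K v" and ab: "a < n" "b < n" "a \<noteq> b" and "K a \<noteq> K b"
  shows "wedge (v a) (v b) \<notin> compatible n K v"
proof
  assume W: "wedge (v a) (v b) \<in> compatible n K v"
  note RD = realizesD[OF R]
  from \<open>K a \<noteq> K b\<close> consider j where "j \<in> K b" "j \<notin> K a" | j where "j \<in> K a" "j \<notin> K b"
    by blast
  then show False
  proof cases
    case 1
    then have "dot n (wedge (v a) (v b) j) (v a) = 0"
      using W ab by (simp add: compatible_def)
    then show False
      using 1 ab RD(2)[OF ab(2), of j] by (simp add: dot_wedge RD(3))
  next
    case 2
    then have "dot n (wedge (v a) (v b) j) (v b) = 0"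
      using W ab by (simp add: compatible_def)
    then show False
      using 2 ab RD(2)[OF ab(1), of j] by (simp add: dot_wedge RD(3))
  qed
qed

section \<open>The upper bound\<close>

text \<open>The independent set \<open>B\<close> stands in for the dimension: each call enlarges it
  by one wedge, so the induction must allow arbitrary \<open>B\<close>. Starting from the empty set
  gives the bound on the length.\<close>

lemma card_independent_plus_length_le:
  assumes "informative_calls n K cs" "realizes n K v"
    and "mat.independent B" "B \<subseteq> compatible n K v"
  shows "card B + length cs \<le> n choose 2"
  using assms
proof (induction cs arbitrary: K v B)
  case Nil
  then have "B \<subseteq> skew_matrices n"
    by (auto simp: compatible_def)
  with Nil show ?case
    using card_independent_skew_le by simp
next
  case (Cons call cs)
  obtain a b where call: "call = (a, b)"
    by (cases call)
  have ab: "a < n" "b < n" "a \<noteq> b" and inf: "informative_calls n (phone_call a b K) cs"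
    and "K a \<noteq> K b"
    using Cons.prems(1) unfolding call by (auto simp: learns_in_call_def phone_call_def)
  let ?W = "wedge (v a) (v b)"
  obtain c s where R: "realizes n (phone_call a b K) (rotate_pair c s a b v)"
    using ex_realizes_phone_call[OF Cons.prems(2) ab] by blast
  \<comment> \<open>Incompatibility with the old state thus gives independence from all of
    \<open>B\<close>, not merely non-membership.\<close>
  have "mat.span B \<subseteq> compatible n K v"
    using Cons.prems(4) subspace_compatible by (rule mat.span_minimal)
  then have notin: "?W \<notin> mat.span B"
    using wedge_not_compatible[OF Cons.prems(2) ab \<open>K a \<noteq> K b\<close>] by blast
  have "finite B"
    using card_independent_skew_le[OF Cons.prems(3)] Cons.prems(4) by (auto simp: compatible_def)
  moreover have "?W \<notin> B"
    using notin mat.span_base by blast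
  moreover have "card (insert ?W B) + length cs \<le> n choose 2"
  proof (rule Cons.IH[OF inf R])
    show "mat.independent (insert ?W B)"
      using notin Cons.prems(3) by (rule mat.independent_insertI)
    show "insert ?W B \<subseteq> compatible n (phone_call a b K) (rotate_pair c s a b v)"
      using wedge_compatible_phone_call[OF Cons.prems(2) ab] Cons.prems(4)
        compatible_phone_call_mono[OF ab(1,2)] by blast
  qed
  ultimately show ?case
    by simp
qed

lemma length_informative_calls_le:
  assumes "informative_calls n initial_knowledge cs"
  shows "length cs \<le> n choose 2"
  using card_independent_plus_length_le[OF assms realizes_initial mat.independent_empty] by simp

section \<open>A sequence attaining the bound\<close>

abbreviation make_calls :: "(nat \<times> nat) list \<Rightarrow> knowledge \<Rightarrow> knowledge" where
  "make_calls \<equiv> fold (\<lambda>(a, b). phone_call a b)"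

lemma informative_calls_append:
  "informative_calls n K (cs @ ds) \<longleftrightarrow>
    informative_calls n K cs \<and> informative_calls n (make_calls cs K) ds"
  by (induction n K cs rule: informative_calls.induct) auto

lemma informative_calls_mono:
  "informative_calls n K cs \<Longrightarrow> n \<le> m \<Longrightarrow> informative_calls m K cs"
  by (induction n K cs rule: informative_calls.induct) auto

lemma make_calls_unchanged:
  "informative_calls n K cs \<Longrightarrow> n \<le> i \<Longrightarrow> make_calls cs K i = K i"
  by (induction n K cs rule: informative_calls.induct) (auto simp: phone_call_def)

text \<open>Calls within a group only spread pieces that someone in the group already has.\<close>

lemma make_calls_not_learn:
  "informative_calls n K cs \<Longrightarrow> \<forall>i<n. x \<notin> K i \<Longrightarrow> i < n \<Longrightarrow> x \<notin> make_calls cs K i"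
  by (induction n K cs rule: informative_calls.induct) (auto simp: phone_call_def)

text \<open>Each \<open>i\<close> learns at least piece \<open>k\<close>. Those still waiting have
  not been in any call of the round, so they still lack it.\<close>

lemma informative_round_of_calls:
  assumes "distinct xs" "\<forall>i\<in>set xs. i < m \<and> i \<noteq> k \<and> k \<notin> K i" "k < m" "k \<in> K k"
  shows "informative_calls m K (map (\<lambda>i. (i, k)) xs)"
  using assms
proof (induction xs arbitrary: K)
  case (Cons i xs)
  have "informative_calls m (phone_call i k K) (map (\<lambda>i. (i, k)) xs)"
    using Cons.prems by (intro Cons.IH) (auto simp: phone_call_def)
  then show ?case
    using Cons.prems by (auto simp: learns_in_call_def phone_call_def)
qed simp

lemma ex_informative_calls_length:
  "\<exists>cs. informative_calls n initial_knowledge cs \<and> length cs = n choose 2"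
proof (induction n)
  case 0
  show ?case
    by (rule exI[of _ "[]"]) simp
next
  case (Suc n)
  then obtain cs where cs: "informative_calls n initial_knowledge cs" "length cs = n choose 2"
    by blast
  let ?ds = "map (\<lambda>i. (i, n)) [0..<n]"
  have "n \<in> make_calls cs initial_knowledge n"
    using make_calls_unchanged[OF cs(1)] by (simp add: initial_knowledge_def)
  moreover have "n \<notin> make_calls cs initial_knowledge i" if "i < n" for i
    using make_calls_not_learn[OF cs(1) _ that] by (simp add: initial_knowledge_def)
  ultimately have "informative_calls (Suc n) (make_calls cs initial_knowledge) ?ds"
    by (intro informative_round_of_calls) auto
  then have "informative_calls (Suc n) initial_knowledge (cs @ ?ds)"
    using informative_calls_mono[OF cs(1)] by (simp add: informative_calls_append)
  \<comment> \<open>Pascal's rule: \<open>n choose 2\<close> plus the \<open>n\<close> new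
    calls.\<close>
  moreover have "length (cs @ ?ds) = Suc n choose 2"
    using cs(2) by (simp add: numeral_2_eq_2)
  ultimately show ?case
    by blast
qed

theorem theorem1p4:
  fixes n :: nat
  assumes "n \<ge> 1"
  shows "(\<forall>cs. informative_calls n initial_knowledge cs \<longrightarrow> length cs \<le> n choose 2) \<and>
         (\<exists>cs. informative_calls n initial_knowledge cs \<and> length cs = n choose 2)"
  using length_informative_calls_le ex_informative_calls_length by blast

end
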